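(* Let $n\ge1$, let $\mathbb{K}=\mathbb{R}$ or $\mathbb{C}$, let $G$ be an abelian subgroup of $GL(n,\mathbb{K})$, and let $u\in\mathbb{K}^n$. (i) If $\mathbb{K}=\mathbb{R}$, then the orbit $G(u)$ is regular with order $m=n$ if and only if it is locally dense (in $\mathbb{R}^n$). (ii) If $\mathbb{K}=\mathbb{C}$, then the orbit $G(u)$ is regular with order $m=2n$ if and only if it is dense in $\mathbb{C}^n$.
   Context: $G\subset GL(n,\mathbb{K})$ acts on $\mathbb{K}^n$ by $(A,v)\mapsto Av$ and $G(u)=\{Au:A\in G\}$. An orbit $\gamma$ is regular with order $m$ if for every $v\in\gamma$ there is an open set $O$ of $\mathbb{K}^n$ containing $v$ such that $\overline{\gamma}\cap O$ is a manifold of dimension $m$ over $\mathbb{R}$. An orbit is locally dense if its closure has nonempty interior. *)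

theory Defs
  imports "HOL-Analysis.Analysis" "HOL-Algebra.Group"
begin

definition GL :: "('a::field ^ 'n::finite ^ 'n) monoid"
  where "GL = \<lparr>carrier = {A. invertible A}, monoid.mult = (**), one = mat 1\<rparr>"

lemma group_GL: "group (GL :: ('a::field ^ 'n::finite ^ 'n) monoid)"
proof (rule groupI)
  fix A :: "'a ^ 'n ^ 'n"
  assume "A \<in> carrier GL"
  then obtain B where "A ** B = mat 1" "B ** A = mat 1"
    by (auto simp: GL_def invertible_def)
  then have "B \<in> carrier GL" "B \<otimes>\<^bsub>GL\<^esub> A = \<one>\<^bsub>GL\<^esub>"
    by (auto simp: GL_def invertible_def)
  then show "\<exists>B\<in>carrier GL. B \<otimes>\<^bsub>GL\<^esub> A = \<one>\<^bsub>GL\<^esub>" ..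
qed (auto simp: GL_def invertible_mult matrix_mul_assoc invertible_def[of "mat 1"])

definition abelian_subgroup_GL :: "('a::field ^ 'n::finite ^ 'n) set \<Rightarrow> bool"
  where "abelian_subgroup_GL G \<longleftrightarrow> subgroup G GL \<and> comm_group (GL\<lparr>carrier := G\<rparr>)"

definition linear_orbit :: "('a::field ^ 'n::finite ^ 'n) set \<Rightarrow> 'a ^ 'n \<Rightarrow> ('a ^ 'n) set"
  where "linear_orbit G u = {A *v u | A. A \<in> G}"

text \<open>Topological manifolds without boundary. The dimension is the real one, since
  \<^term>\<open>Euclidean_space m\<close> is the topological space of real \<^term>\<open>m\<close>-tuples.\<close>

definition topological_manifold :: "nat \<Rightarrow> 'a topology \<Rightarrow> bool"
  where "topological_manifold m X \<longleftrightarrow>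
    Hausdorff_space X \<and> second_countable X \<and>
    (\<forall>x\<in>topspace X. \<exists>U V. openin X U \<and> x \<in> U \<and> openin (Euclidean_space m) V \<and>
        subtopology X U homeomorphic_space subtopology (Euclidean_space m) V)"

definition regular_with_order :: "'a::topological_space set \<Rightarrow> nat \<Rightarrow> bool"
  where "regular_with_order \<gamma> m \<longleftrightarrow>
    (\<forall>v\<in>\<gamma>. \<exists>W. open W \<and> v \<in> W \<and> topological_manifold m (top_of_set (closure \<gamma> \<inter> W)))"

definition locally_dense :: "'a::topological_space set \<Rightarrow> bool"
  where "locally_dense S \<longleftrightarrow> interior (closure S) \<noteq> {}"

end

theory Submission
  imports Defs "HOL-Homology.Invariance_of_Domain" "HOL-Computational_Algebra.Polynomial"
begin

text \<open>Write \<open>\<gamma>\<close> for the orbit and \<open>K\<close> for its closure.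

  By invariance of domain, a subset of a Euclidean space is a manifold of the full dimension exactly
  when it is open. Hence \<open>\<gamma>\<close> is regular with the full real order if and only if every point of
  \<open>\<gamma>\<close> is interior to \<open>K\<close>. If a single point of \<open>K\<close> is interior, then \<open>\<gamma>\<close> meets the interior,
  and since \<open>G\<close> acts transitively on \<open>\<gamma>\<close> by homeomorphisms that preserve \<open>K\<close>, every point of
  \<open>\<gamma>\<close> is interior. So, over both fields, regularity with the full order means local density
  (\<open>regular_orbit_iff_locally_dense\<close>).

  Over the complex numbers local density implies density. Two properties of the matrices that
  commute with all of \<open>G\<close> are behind this.
  \<^item> If such a matrix sends \<open>u\<close> into \<open>K\<close>, then it sends \<open>K\<close> into \<open>K\<close>; if it is moreover invertible,
    it sends the interior of \<open>K\<close> into itself (\<open>commuting_invertible_matrix_maps_interior\<close>).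
  \<^item> If \<open>\<gamma>\<close> is locally dense, every vector \<open>w\<close> has the form \<open>A u\<close> for such a matrix \<open>A\<close>: the
    vectors of this form are a real subspace that contains \<open>\<gamma>\<close>, hence \<open>K\<close>
    (\<open>commutant_acts_transitively\<close>).

  Given \<open>w = A u\<close>, consider the matrices \<open>M(z) = 1 + z (A - 1)\<close> for complex \<open>z\<close>, which commute
  with \<open>G\<close> and send \<open>u\<close> to \<open>u + z (w - u)\<close>. The determinant of \<open>M(z)\<close> is a nonzero polynomial in \<open>z\<close>, so
  \<open>M(z)\<close> is invertible outside a finite set, whose complement in the complex plane is connected
  and dense. On this complement the condition that \<open>M(z) u\<close> lies in \<open>K\<close> is closed, and also open:
  an invertible \<open>M(z)\<close> with \<open>M(z) u\<close> in \<open>K\<close> carries the interior point \<open>u\<close> to an interior point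
  of \<open>K\<close>. It holds at \<open>z = 0\<close>, so it holds on the whole complement, by density and
  continuity for all \<open>z\<close>, and \<open>z = 1\<close> gives that \<open>w\<close> is in \<open>K\<close>. Over
  the reals this argument breaks down because removing a point disconnects a line.\<close>

section \<open>Full-dimensional manifolds in a Euclidean space\<close>

lemma second_countable_euclidean: "second_countable (euclidean :: 'a::second_countable_topology topology)"
proof -
  obtain \<B> :: "'a set set" where "countable \<B>" "\<And>C. C \<in> \<B> \<Longrightarrow> open C"
    "\<And>S. open S \<Longrightarrow> \<exists>U. U \<subseteq> \<B> \<and> S = \<Union>U"
    using univ_second_countable by blast
  then have "\<exists>U\<in>\<B>. x \<in> U \<and> U \<subseteq> S" if "open S" "x \<in> S" for S x
    using that by (metis Sup_upper UnionE subsetD)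
  with \<open>countable \<B>\<close> \<open>\<And>C. C \<in> \<B> \<Longrightarrow> open C\<close> show ?thesis
    unfolding second_countable_def by (intro exI[of _ \<B>]) simp
qed

text \<open>A chart around a point of \<open>S\<close> gives a continuous injection from an open set of the ambient
  space onto a relatively open neighbourhood of that point. By invariance of domain this
  neighbourhood is open in the ambient space.\<close>

lemma topological_manifold_top_of_set_iff_open:
  fixes S :: "'a::euclidean_space set"
  shows "topological_manifold DIM('a) (top_of_set S) \<longleftrightarrow> open S"
proof -
  let ?E = "Euclidean_space DIM('a)"
  obtain f :: "(nat \<Rightarrow> real) \<Rightarrow> 'a" and g where fg: "homeomorphic_maps ?E euclidean f g"
    using homeomorphic_maps_Euclidean_space_euclidean .
  then have f: "homeomorphic_map ?E euclidean f" and g: "homeomorphic_map euclidean ?E g"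
    by (auto simp: homeomorphic_maps_map)
  show ?thesis
  proof
    assume S: "topological_manifold DIM('a) (top_of_set S)"
    show "open S"
      unfolding open_subopen[of S]
    proof
      fix x assume "x \<in> S"
      then obtain U V where U: "openin (top_of_set S) U" "x \<in> U" and V: "openin ?E V"
        and UV: "subtopology (top_of_set S) U homeomorphic_space subtopology ?E V"
        using S unfolding topological_manifold_def by auto
      have "U \<subseteq> S"
        using U(1) by (rule openin_imp_subset)
      have "open (f ` V)"
        using V f homeomorphic_imp_open_map open_map_def open_openin by blast
      have "homeomorphic_map (subtopology ?E V) (top_of_set (f ` V)) f"
        using openin_subset[OF V] by (intro homeomorphic_map_subtopologies[OF f]) auto
      then have "subtopology ?E V homeomorphic_space top_of_set (f ` V)"
        by (rule homeomorphic_map_imp_homeomorphic_space)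
      with UV have "subtopology (top_of_set S) U homeomorphic_space top_of_set (f ` V)"
        by (rule homeomorphic_space_trans)
      then have "U homeomorphic f ` V"
        using \<open>U \<subseteq> S\<close> by (simp add: subtopology_subtopology inf.absorb2)
      then have "f ` V homeomorphic U"
        by (rule homeomorphic_sym[THEN iffD1])
      then obtain h k where hk: "homeomorphism (f ` V) U h k"
        unfolding homeomorphic_def by blast
      then have "open (h ` f ` V)"
        using \<open>open (f ` V)\<close>
        by (metis homeomorphism_cont1 homeomorphism_apply1 inj_on_inverseI invariance_of_domain)
      then have "open U"
        using hk by (simp add: homeomorphism_def)
      with U(2) \<open>U \<subseteq> S\<close> show "\<exists>T. open T \<and> x \<in> T \<and> T \<subseteq> S"
        by blast
    qed
  next
    assume S: "open S"
    have "openin ?E (g ` S)"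
      using S g homeomorphic_imp_open_map open_map_def open_openin by blast
    moreover have "homeomorphic_map (top_of_set S) (subtopology ?E (g ` S)) g"
      using openin_subset[OF calculation] by (intro homeomorphic_map_subtopologies[OF g]) auto
    then have "subtopology (top_of_set S) S homeomorphic_space subtopology ?E (g ` S)"
      by (simp add: subtopology_subtopology homeomorphic_map_imp_homeomorphic_space)
    ultimately have "\<forall>x\<in>S. \<exists>U V. openin (top_of_set S) U \<and> x \<in> U \<and> openin ?E V \<and>
        subtopology (top_of_set S) U homeomorphic_space subtopology ?E V"
      using openin_subtopology_self by blast
    then show "topological_manifold DIM('a) (top_of_set S)"
      unfolding topological_manifold_def
      by (simp add: Hausdorff_space_subtopology second_countable_subtopology second_countable_euclidean)
  qed
qed

lemma regular_with_order_DIM_iff: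
  fixes \<gamma> :: "'a::euclidean_space set"
  shows "regular_with_order \<gamma> DIM('a) \<longleftrightarrow> \<gamma> \<subseteq> interior (closure \<gamma>)"
proof
  assume reg: "regular_with_order \<gamma> DIM('a)"
  show "\<gamma> \<subseteq> interior (closure \<gamma>)"
  proof
    fix v assume "v \<in> \<gamma>"
    then obtain W where "open (closure \<gamma> \<inter> W)" "v \<in> W"
      using reg by (auto simp: regular_with_order_def topological_manifold_top_of_set_iff_open)
    then show "v \<in> interior (closure \<gamma>)"
      using \<open>v \<in> \<gamma>\<close> closure_subset by (blast intro: interiorI)
  qed
next
  assume "\<gamma> \<subseteq> interior (closure \<gamma>)"
  moreover have "closure \<gamma> \<inter> interior (closure \<gamma>) = interior (closure \<gamma>)"
    using interior_subset by blast
  ultimately show "regular_with_order \<gamma> DIM('a)"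
    unfolding regular_with_order_def topological_manifold_top_of_set_iff_open
    by (metis open_interior subsetD)
qed

section \<open>Matrices commuting with the group\<close>

lemma matrix_add_rdistrib: "(A + B) ** C = A ** C + B ** C"
  for A B :: "'a::semiring_1^'m^'n"
  by (simp add: matrix_matrix_mult_def vec_eq_iff sum.distrib distrib_right)

lemma abelian_subgroup_GL_D:
  assumes "abelian_subgroup_GL G"
  shows "A \<in> G \<Longrightarrow> invertible A"
    and "mat 1 \<in> G"
    and "A \<in> G \<Longrightarrow> B \<in> G \<Longrightarrow> A ** B \<in> G"
    and "A \<in> G \<Longrightarrow> B \<in> G \<Longrightarrow> A ** B = B ** A"
    and "A \<in> G \<Longrightarrow> \<exists>B\<in>G. B ** A = mat 1"
proof -
  have sub: "subgroup G GL" and comm: "comm_group (GL\<lparr>carrier := G\<rparr>)"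
    using assms by (auto simp: abelian_subgroup_GL_def)
  show "A \<in> G \<Longrightarrow> invertible A"
    using subgroup.subset[OF sub] by (auto simp: GL_def)
  show "mat 1 \<in> G"
    using subgroup.one_closed[OF sub] by (simp add: GL_def)
  show "A \<in> G \<Longrightarrow> B \<in> G \<Longrightarrow> A ** B \<in> G"
    using subgroup.m_closed[OF sub, of A B] by (simp add: GL_def)
  show "A \<in> G \<Longrightarrow> B \<in> G \<Longrightarrow> A ** B = B ** A"
    using comm_monoid.m_comm[OF comm_group.axioms(1)[OF comm], of A B] by (simp add: GL_def)
  show "\<exists>B\<in>G. B ** A = mat 1" if "A \<in> G"
    using group.l_inv_ex[OF comm_group.axioms(2)[OF comm], of A] that by (simp add: GL_def)
qed

text \<open>For \<open>B\<close> in \<open>G\<close> one has \<open>A (B u) = B (A u)\<close>, and \<open>B\<close> preserves the closure of the orbit, which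
  contains \<open>A u\<close>. So \<open>A\<close> sends the orbit into its closure, and by continuity also the closure.\<close>

lemma commuting_matrix_maps_orbit_closure:
  fixes A :: "'a::{real_normed_field,euclidean_space}^'n^'n"
  assumes comm: "\<And>B. B \<in> G \<Longrightarrow> A ** B = B ** A"
    and mult: "\<And>B C. B \<in> G \<Longrightarrow> C \<in> G \<Longrightarrow> B ** C \<in> G"
    and Au: "A *v u \<in> closure (linear_orbit G u)"
    and v: "v \<in> closure (linear_orbit G u)"
  shows "A *v v \<in> closure (linear_orbit G u)"
proof -
  have cont: "continuous_on S ((*v) B)" for S and B :: "'a^'n^'n"
    by (simp add: linear_continuous_on)
  have "B *v x \<in> closure (linear_orbit G u)" if "B \<in> G" "x \<in> closure (linear_orbit G u)" for B x
  proof -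
    have "(*v) B ` linear_orbit G u \<subseteq> linear_orbit G u"
      using mult[OF that(1)] by (auto simp: linear_orbit_def matrix_vector_mul_assoc)
    then have "(*v) B ` closure (linear_orbit G u) \<subseteq> closure (linear_orbit G u)"
      by (intro image_closure_subset cont) (use closure_subset in auto)
    then show ?thesis using that(2) by blast
  qed
  then have "A *v (B *v u) \<in> closure (linear_orbit G u)" if "B \<in> G" for B
    using Au that by (metis comm matrix_vector_mul_assoc)
  then have "(*v) A ` linear_orbit G u \<subseteq> closure (linear_orbit G u)"
    by (auto simp: linear_orbit_def)
  then have "(*v) A ` closure (linear_orbit G u) \<subseteq> closure (linear_orbit G u)"
    by (intro image_closure_subset cont) auto
  then show ?thesis using v by blast
qed

lemma commuting_invertible_matrix_maps_interior:
  fixes A :: "'a::{real_normed_field,euclidean_space}^'n^'n"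
  assumes "\<And>B. B \<in> G \<Longrightarrow> A ** B = B ** A"
    and "\<And>B C. B \<in> G \<Longrightarrow> C \<in> G \<Longrightarrow> B ** C \<in> G"
    and "A *v u \<in> closure (linear_orbit G u)"
    and inv: "invertible A"
    and v: "v \<in> interior (closure (linear_orbit G u))"
  shows "A *v v \<in> interior (closure (linear_orbit G u))"
proof (rule interiorI)
  let ?I = "interior (closure (linear_orbit G u))"
  show "open ((*v) A ` ?I)"
    using inv inj_matrix_vector_mult[OF inv]
    by (intro invariance_of_domain) (auto simp: linear_continuous_on intro: inj_on_subset)
  show "(*v) A ` ?I \<subseteq> closure (linear_orbit G u)"
    using commuting_matrix_maps_orbit_closure[OF assms(1-3)] interior_subset by blast
  show "A *v v \<in> (*v) A ` ?I"
    using v by blast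
qed

text \<open>The orbit meets the interior of its closure in some \<open>B u\<close>, and the matrix \<open>A B\<^sup>-\<^sup>1\<close> of \<open>G\<close> moves
  this point to an arbitrary point \<open>A u\<close> of the orbit.\<close>

lemma locally_dense_orbit_iff_subset_interior:
  fixes G :: "('a::{real_normed_field,euclidean_space}^'n^'n) set"
  assumes G: "abelian_subgroup_GL G"
  shows "locally_dense (linear_orbit G u) \<longleftrightarrow>
         linear_orbit G u \<subseteq> interior (closure (linear_orbit G u))"
proof
  let ?\<gamma> = "linear_orbit G u"
  note grp = abelian_subgroup_GL_D[OF G]
  assume "locally_dense ?\<gamma>"
  then have "?\<gamma> \<inter> interior (closure ?\<gamma>) \<noteq> {}"
    unfolding locally_dense_def using open_Int_closure_eq_empty[OF open_interior, of "closure ?\<gamma>" ?\<gamma>]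
      interior_subset[of "closure ?\<gamma>"] by blast
  then obtain B where B: "B \<in> G" "B *v u \<in> interior (closure ?\<gamma>)"
    by (auto simp: linear_orbit_def)
  then obtain B' where B': "B' \<in> G" "B' ** B = mat 1"
    using grp(5) by blast
  show "?\<gamma> \<subseteq> interior (closure ?\<gamma>)"
  proof
    fix v assume "v \<in> ?\<gamma>"
    then obtain A where A: "A \<in> G" "v = A *v u"
      by (auto simp: linear_orbit_def)
    have AB: "A ** B' \<in> G"
      using A B' grp by blast
    have "(A ** B') *v u \<in> closure ?\<gamma>"
      using AB closure_subset by (fastforce simp: linear_orbit_def)
    then have "(A ** B') *v (B *v u) \<in> interior (closure ?\<gamma>)"
      using commuting_invertible_matrix_maps_interior[of G "A ** B'" u "B *v u"] AB B(2) grp by blast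
    also have "(A ** B') *v (B *v u) = v"
      using A(2) B'(2) by (metis matrix_mul_assoc matrix_mul_rid matrix_vector_mul_assoc)
    finally show "v \<in> interior (closure ?\<gamma>)" .
  qed
next
  have "u \<in> linear_orbit G u"
    using abelian_subgroup_GL_D(2)[OF G] by (force simp: linear_orbit_def)
  moreover assume "linear_orbit G u \<subseteq> interior (closure (linear_orbit G u))"
  ultimately show "locally_dense (linear_orbit G u)"
    by (auto simp: locally_dense_def)
qed

lemma regular_orbit_iff_locally_dense:
  fixes G :: "('a::{real_normed_field,euclidean_space}^'n^'n) set"
  assumes "abelian_subgroup_GL G"
  shows "regular_with_order (linear_orbit G u) DIM('a^'n) \<longleftrightarrow> locally_dense (linear_orbit G u)"
  using assms by (simp only: regular_with_order_DIM_iff locally_dense_orbit_iff_subset_interior)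

text \<open>The commutant of \<open>G\<close> is a linear space of matrices that contains \<open>G\<close>. Its image at \<open>u\<close> is
  therefore a closed subspace containing the orbit, and a proper subspace has empty interior.\<close>

lemma commutant_acts_transitively:
  fixes G :: "('a::{real_normed_field,euclidean_space}^'n^'n) set"
  assumes G: "abelian_subgroup_GL G" and dense: "locally_dense (linear_orbit G u)"
  obtains A where "A *v u = w" "\<And>B. B \<in> G \<Longrightarrow> A ** B = B ** A"
proof -
  define S where "S = {A *v u | A. \<forall>B\<in>G. A ** B = B ** A}"
  have "subspace S"
    unfolding subspace_def
  proof (intro conjI ballI allI)
    show "0 \<in> S"
      unfolding S_def by (intro CollectI exI[of _ 0]) simp
  next
    fix x y assume "x \<in> S" "y \<in> S"
    then obtain A A' where A: "x = A *v u" "\<forall>B\<in>G. A ** B = B ** A"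
      and A': "y = A' *v u" "\<forall>B\<in>G. A' ** B = B ** A'"
      unfolding S_def by blast
    then show "x + y \<in> S"
      unfolding S_def by (intro CollectI exI[of _ "A + A'"])
        (simp add: matrix_vector_mult_add_rdistrib matrix_add_ldistrib matrix_add_rdistrib)
  next
    fix c :: real and x assume "x \<in> S"
    then obtain A where A: "x = A *v u" "\<forall>B\<in>G. A ** B = B ** A"
      unfolding S_def by blast
    have "(c *\<^sub>R A) ** B = c *\<^sub>R (A ** B)" "B ** (c *\<^sub>R A) = c *\<^sub>R (B ** A)" for B
      by (simp_all add: matrix_matrix_mult_def vec_eq_iff scaleR_sum_right)
    moreover have "(c *\<^sub>R A) *v u = c *\<^sub>R (A *v u)"
      by (simp add: matrix_vector_mult_def vec_eq_iff scaleR_sum_right)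
    ultimately show "c *\<^sub>R x \<in> S"
      using A unfolding S_def by (intro CollectI exI[of _ "c *\<^sub>R A"]) simp
  qed
  have "linear_orbit G u \<subseteq> S"
    using abelian_subgroup_GL_D(4)[OF G] unfolding linear_orbit_def S_def by blast
  then have "closure (linear_orbit G u) \<subseteq> S"
    using \<open>subspace S\<close> by (simp add: closed_subspace closure_minimal)
  then have "interior S \<noteq> {}"
    using dense interior_mono unfolding locally_dense_def by blast
  then have "span S = UNIV"
    using empty_interior_lowdim[of S] dim_eq_full[of S] dim_subset_UNIV[of S] by linarith
  then have "w \<in> S"
    using \<open>subspace S\<close> by (metis UNIV_I span_eq_iff)
  then show thesis
    using that unfolding S_def by blast
qed

section \<open>Complex lines\<close>

lemma mat_matrix_mult_component: "(mat c ** A) $ i $ j = c * A $ i $ j"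
  for A :: "'a::semiring_1^'m^'n"
  by (simp add: matrix_matrix_mult_def mat_def if_distrib[of "\<lambda>x. x * _"] cong: if_cong)

lemma mat_mult_vec: "mat c *v x = c *s x"
  for x :: "'a::semiring_1^'n"
  by (simp add: matrix_vector_mult_def mat_def vec_eq_iff if_distrib[of "\<lambda>x. x * _"] cong: if_cong)

lemma mat_commute: "mat c ** A = A ** mat c"
  for A :: "'a::comm_semiring_1^'n^'n"
  by (simp add: vec_eq_iff mat_matrix_mult_component)
    (simp add: matrix_matrix_mult_def mat_def mult.commute if_distrib[of "\<lambda>x. _ * x"] cong: if_cong)

text \<open>The determinant of \<open>A + z B\<close> is a polynomial in \<open>z\<close>, obtained by taking the determinant over
  the polynomial ring, and its value at \<open>0\<close> is \<open>det A\<close>.\<close>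

lemma finite_singular_in_pencil:
  fixes A B :: "'a::idom^'n^'n"
  assumes "det A \<noteq> 0"
  shows "finite {z. det (A + mat z ** B) = 0}"
proof -
  define P where "P = det (\<chi> i j. [:A $ i $ j, B $ i $ j:])"
  have P: "poly P z = det (A + mat z ** B)" for z
    unfolding P_def det_def by (simp add: poly_sum poly_prod mat_matrix_mult_component)
  have "P \<noteq> 0"
    using P[of 0] assms by auto
  then show ?thesis
    using poly_roots_finite[of P] by (simp add: P)
qed

text \<open>This is the connectedness argument along the complex line from \<open>u\<close> to an arbitrary \<open>w\<close>.
  Complex parameters are essential: the plane stays connected without the finite set \<open>F\<close> at which
  the matrices become singular.\<close>

lemma locally_dense_complex_orbit_imp_dense:
  fixes G :: "(complex^'n^'n) set"
  assumes G: "abelian_subgroup_GL G" and dense: "locally_dense (linear_orbit G u)"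
  shows "closure (linear_orbit G u) = UNIV"
proof (intro equalityI subset_UNIV subsetI)
  fix w
  let ?K = "closure (linear_orbit G u)"
  note grp = abelian_subgroup_GL_D[OF G]
  obtain A where A: "A *v u = w" "\<And>B. B \<in> G \<Longrightarrow> A ** B = B ** A"
    using commutant_acts_transitively[OF G dense] by blast
  define M where "M z = mat 1 + mat z ** (A - mat 1)" for z
  define l where "l z = u + z *s (w - u)" for z
  have Mu: "M z *v u = l z" for z
    by (simp add: M_def l_def A(1) mat_mult_vec matrix_vector_mult_add_rdistrib
        matrix_vector_mult_diff_rdistrib flip: matrix_vector_mul_assoc)
  have M_comm: "M z ** B = B ** M z" if "B \<in> G" for z B
  proof -
    have "(A - mat 1) ** B = B ** (A - mat 1)"
      using A(2)[OF that] by (simp add: matrix_eq matrix_vector_mult_diff_rdistrib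
          matrix_vector_mult_diff_distrib flip: matrix_vector_mul_assoc)
    then have "(mat z ** (A - mat 1)) ** B = B ** (mat z ** (A - mat 1))"
      by (metis mat_commute matrix_mul_assoc)
    then show ?thesis
      by (simp add: M_def matrix_add_ldistrib matrix_add_rdistrib)
  qed
  define F where "F = {z. det (M z) = 0}"
  have "finite F"
    unfolding F_def M_def by (rule finite_singular_in_pencil) simp
  have conn: "connected (- F)"
    using \<open>finite F\<close> by (intro path_connected_imp_connected path_connected_complement_countable)
      (auto simp: countable_finite)
  have l: "continuous_on X l" for X
    unfolding l_def vector_scalar_mult_def by (intro continuous_intros)
  have "u \<in> linear_orbit G u"
    using grp(2) by (force simp: linear_orbit_def)
  then have u: "u \<in> interior ?K"
    using dense G locally_dense_orbit_iff_subset_interior by blast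
  \<comment> \<open>This is the openness half of the connectedness argument: over the regular parameters, the line
    meets the closure of the orbit only in interior points.\<close>
  have "l z \<in> interior ?K" if "z \<in> - F" "l z \<in> ?K" for z
    using commuting_invertible_matrix_maps_interior[of G "M z" u u] M_comm grp(3) that u Mu
    by (auto simp: F_def invertible_det_nz)
  then have eq: "- F \<inter> l -` ?K = - F \<inter> l -` interior ?K"
    using interior_subset by blast
  have "closedin (top_of_set (- F)) (- F \<inter> l -` ?K)"
    by (intro continuous_closedin_preimage l) simp
  moreover have "openin (top_of_set (- F)) (- F \<inter> l -` ?K)"
    unfolding eq by (intro continuous_openin_preimage_gen l) simp
  moreover have "0 \<in> - F \<inter> l -` ?K"
    using u interior_subset by (auto simp: F_def M_def l_def)
  ultimately have "- F \<subseteq> l -` ?K"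
    using conn unfolding connected_clopen by blast
  moreover have "closed (l -` ?K)"
    using l by (intro closed_vimage) auto
  ultimately have "closure (- F) \<subseteq> l -` ?K"
    by (rule closure_minimal)
  moreover have "closure (- F) = UNIV"
    using \<open>finite F\<close> by (simp add: closure_complement empty_interior_finite)
  ultimately have "l 1 \<in> ?K"
    by blast
  then show "w \<in> ?K"
    by (simp add: l_def)
qed

theorem corollary1p4:
  shows "(\<forall>(G :: (real ^ 'n::finite ^ 'n) set) (u :: real ^ 'n). abelian_subgroup_GL G \<longrightarrow>
            (regular_with_order (linear_orbit G u) CARD('n) \<longleftrightarrow>
             locally_dense (linear_orbit G u)))
       \<and> (\<forall>(G :: (complex ^ 'n ^ 'n) set) (u :: complex ^ 'n). abelian_subgroup_GL G \<longrightarrow>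
            (regular_with_order (linear_orbit G u) (2 * CARD('n)) \<longleftrightarrow>
             closure (linear_orbit G u) = UNIV))"
proof (intro conjI allI impI)
  fix G :: "(real^'n^'n) set" and u :: "real^'n"
  assume "abelian_subgroup_GL G"
  from regular_orbit_iff_locally_dense[OF this, of u]
  show "regular_with_order (linear_orbit G u) CARD('n) \<longleftrightarrow> locally_dense (linear_orbit G u)"
    by simp
next
  fix G :: "(complex^'n^'n) set" and u :: "complex^'n"
  assume G: "abelian_subgroup_GL G"
  have "regular_with_order (linear_orbit G u) (2 * CARD('n)) \<longleftrightarrow> locally_dense (linear_orbit G u)"
    using regular_orbit_iff_locally_dense[OF G, of u] by (simp add: mult.commute)
  also have "\<dots> \<longleftrightarrow> closure (linear_orbit G u) = UNIV"
    using locally_dense_complex_orbit_imp_dense[OF G] by (auto simp: locally_dense_def)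
  finally show "regular_with_order (linear_orbit G u) (2 * CARD('n)) \<longleftrightarrow>
      closure (linear_orbit G u) = UNIV" .
qed

end
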